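(* For every integer $n\ge 1$, the set $\mathcal{CS}_+^n$ of $n\times n$ completely positive semidefinite matrices is a convex cone.
   Context: $\mathcal S^d$ denotes the real symmetric $d\times d$ matrices with trace inner product $\langle X,Y\rangle=\mathrm{Tr}(XY)$, and $\mathcal S^d_+$ the positive semidefinite ones. A matrix $A\in\mathcal S^n$ is completely positive semidefinite if there exist $d\ge 1$ and $X_1,\dots,X_n\in\mathcal S^d_+$ with $A_{ij}=\langle X_i,X_j\rangle$ for all $i,j\in\{1,\dots,n\}$. $\mathcal{CS}_+^n$ is the set of all such matrices. *)

theory Defs
  imports "HOL-Analysis.Analysis" "Jordan_Normal_Form.Matrix"
begin

(* Two matrix types are in play. The size n of a completely positive semidefinite matrix is fixed
   throughout, so such matrices have type real^'n^'n, a real vector space to which the library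
   predicate convex_cone applies; 'n plays the role of the index set {1..n}. The size d of the
   factors is existentially quantified, so these are carrier-based matrices of type real mat. *)

no_notation vec_index (infixl \<open>$\<close> 100)

definition sym_mats :: "nat \<Rightarrow> real Matrix.mat set" where
  "sym_mats d = {X \<in> carrier_mat d d. transpose_mat X = X}"

definition psd_mats :: "nat \<Rightarrow> real Matrix.mat set" where
  "psd_mats d = {X \<in> sym_mats d. \<forall>v \<in> carrier_vec d. 0 \<le> scalar_prod v (X *\<^sub>v v)}"

definition mat_trace :: "real Matrix.mat \<Rightarrow> real" where
  "mat_trace X = (\<Sum>i<dim_row X. X $$ (i, i))"

definition trace_inner :: "real Matrix.mat \<Rightarrow> real Matrix.mat \<Rightarrow> real" where
  "trace_inner X Y = mat_trace (X * Y)"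

definition completely_psd :: "real^'n^'n \<Rightarrow> bool" where
  "completely_psd A \<longleftrightarrow> transpose A = A \<and>
     (\<exists>d\<ge>1. \<exists>X :: 'n \<Rightarrow> real Matrix.mat.
        (\<forall>i. X i \<in> psd_mats d) \<and> (\<forall>i j. A $ i $ j = trace_inner (X i) (X j)))"

definition CS_plus :: "(real^'n^'n) set" where
  "CS_plus = {A. completely_psd A}"

end

theory Submission
  imports Defs
begin

text \<open>A sum of two Gram matrices of positive semidefinite matrices is the Gram matrix of the
  block-diagonal sums of the factors, and scaling a Gram matrix by \<open>c\<close> amounts to scaling its
  factors by \<open>sqrt c\<close>.\<close>

lemma psd_mats_carrier: "X \<in> psd_mats d \<Longrightarrow> X \<in> carrier_mat d d"
  by (simp add: psd_mats_def sym_mats_def)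

lemma zero_psd_mats: "0\<^sub>m d d \<in> psd_mats d"
proof -
  have "scalar_prod v (0\<^sub>m d d *\<^sub>v v) = 0" if "v \<in> carrier_vec d" for v :: "real Matrix.vec"
    using that by (simp add: scalar_prod_def)
  then show ?thesis
    by (simp add: psd_mats_def sym_mats_def)
qed

lemma smult_psd_mats:
  assumes "0 \<le> c" and "X \<in> psd_mats d"
  shows "c \<cdot>\<^sub>m X \<in> psd_mats d"
proof -
  have X: "X \<in> carrier_mat d d"
    using assms(2) by (rule psd_mats_carrier)
  have "scalar_prod v ((c \<cdot>\<^sub>m X) *\<^sub>v v) = c * scalar_prod v (X *\<^sub>v v)"
    if v: "v \<in> carrier_vec d" for v
  proof -
    have "(c \<cdot>\<^sub>m X) *\<^sub>v v = c \<cdot>\<^sub>v (X *\<^sub>v v)"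
      using X v by (intro eq_vecI) auto
    then show ?thesis
      using X v by simp
  qed
  moreover have "transpose_mat (c \<cdot>\<^sub>m X) = c \<cdot>\<^sub>m transpose_mat X"
    by (intro eq_matI) auto
  ultimately show ?thesis
    using assms X by (auto simp: psd_mats_def sym_mats_def)
qed

lemma trace_inner_smult:
  assumes "X \<in> carrier_mat d d" and "Y \<in> carrier_mat d d"
  shows "trace_inner (a \<cdot>\<^sub>m X) (b \<cdot>\<^sub>m Y) = a * b * trace_inner X Y"
  using assms by (simp add: trace_inner_def mat_trace_def sum_distrib_left algebra_simps)

text \<open>The sizes of the zero blocks are read off the arguments, so this is a plain binary
  operation without size parameters.\<close>

definition diag_sum :: "real Matrix.mat \<Rightarrow> real Matrix.mat \<Rightarrow> real Matrix.mat" where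
  "diag_sum X Y =
    four_block_mat X (0\<^sub>m (dim_row X) (dim_col Y)) (0\<^sub>m (dim_row Y) (dim_col X)) Y"

text \<open>Cut a vector after its first \<open>d\<close> entries. The zero blocks remove the cross
  terms, so the quadratic form is the sum of the forms of \<open>X\<close> and \<open>Y\<close> at
  the two pieces, both nonnegative.\<close>

lemma diag_sum_psd_mats:
  assumes "X \<in> psd_mats d" and "Y \<in> psd_mats e"
  shows "diag_sum X Y \<in> psd_mats (d + e)"
proof -
  have X: "X \<in> carrier_mat d d" and Y: "Y \<in> carrier_mat e e"
    using assms by (auto intro: psd_mats_carrier)
  have "0 \<le> scalar_prod v (diag_sum X Y *\<^sub>v v)" if v: "v \<in> carrier_vec (d + e)" for v
  proof -
    define a b where "a = vec_first v d" and "b = vec_last v e"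
    have a: "a \<in> carrier_vec d" and b: "b \<in> carrier_vec e" and v_eq: "v = a @\<^sub>v b"
      using v by (auto simp: a_def b_def)
    have "diag_sum X Y *\<^sub>v v = (X *\<^sub>v a) @\<^sub>v (Y *\<^sub>v b)"
      using X Y mult_mat_vec_split[OF X Y a b] by (simp add: diag_sum_def v_eq)
    then have "scalar_prod v (diag_sum X Y *\<^sub>v v)
        = scalar_prod a (X *\<^sub>v a) + scalar_prod b (Y *\<^sub>v b)"
      using X Y a b by (simp add: v_eq scalar_prod_append[of _ d _ e])
    then show ?thesis
      using assms a b by (simp add: psd_mats_def)
  qed
  then show ?thesis
    using assms X Y
    by (auto simp: psd_mats_def sym_mats_def diag_sum_def transpose_four_block_mat[of _ d d _ e _ e])
qed

text \<open>As \<open>A\<close> and \<open>D\<close> are square, the diagonal of the block matrix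
  meets only these two blocks.\<close>

lemma mat_trace_four_block_mat:
  "mat_trace (four_block_mat A B C D) = mat_trace A + mat_trace D"
  if "A \<in> carrier_mat d d" and "D \<in> carrier_mat e e"
proof -
  \<comment> \<open>A diagonal position \<open>i \<ge> d\<close> of the block matrix is position
    \<open>i - d\<close> of \<open>D\<close>.\<close>
  have "(\<Sum>i = d..<d + e. D $$ (i - d, i - d)) = (\<Sum>i = 0..<e. D $$ (i, i))"
    using sum.shift_bounds_nat_ivl[of "\<lambda>i. D $$ (i - d, i - d)" 0 d e] by (simp add: add.commute)
  then have "(\<Sum>i<d + e. four_block_mat A B C D $$ (i, i))
      = (\<Sum>i<d. A $$ (i, i)) + (\<Sum>i<e. D $$ (i, i))"
    using that by (simp add: lessThan_atLeast0
        sum.atLeastLessThan_concat[of 0 d "d + e", symmetric])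
  then show ?thesis
    using that by (simp add: mat_trace_def)
qed

text \<open>Block-diagonal matrices multiply block by block, and the trace adds over the diagonal
  blocks. This is why Gram matrices add when their factors are joined in this way.\<close>

lemma trace_inner_diag_sum:
  assumes "X \<in> carrier_mat d d" "X' \<in> carrier_mat d d"
    and "Y \<in> carrier_mat e e" "Y' \<in> carrier_mat e e"
  shows "trace_inner (diag_sum X Y) (diag_sum X' Y') = trace_inner X X' + trace_inner Y Y'"
proof -
  have "diag_sum X Y * diag_sum X' Y'
      = four_block_mat (X * X') (0\<^sub>m d e) (0\<^sub>m e d) (Y * Y')"
    using assms by (simp add: diag_sum_def mult_four_block_mat[of _ d d _ e _ e _ _ d _ e])
  then show ?thesis
    using assms by (simp add: trace_inner_def mat_trace_four_block_mat[of _ d _ e])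
qed

lemma completely_psd_zero: "completely_psd 0"
  unfolding completely_psd_def
\<comment> \<open>Factors of size 1 are the smallest that \<open>d \<ge> 1\<close> admits.\<close>
proof (intro conjI exI[of _ 1] exI[of _ "\<lambda>_. 0\<^sub>m 1 1"])
  show "transpose 0 = (0 :: real^'n^'n)"
    by (simp add: transpose_def Finite_Cartesian_Product.vec_eq_iff)
qed (auto simp: zero_psd_mats trace_inner_def mat_trace_def)

lemma completely_psd_add:
  assumes "completely_psd A" and "completely_psd B"
  shows "completely_psd (A + B)"
proof -
  obtain d X where X: "d \<ge> 1" "\<And>i. X i \<in> psd_mats d" "\<And>i j. A $ i $ j = trace_inner (X i) (X j)"
    using assms(1) unfolding completely_psd_def by blast
  \<comment> \<open>The factor sizes \<open>d\<close> and \<open>e\<close> may differ, which block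
    sums allow. The new size satisfies \<open>d + e \<ge> 1\<close> because
    \<open>d \<ge> 1\<close>.\<close>
  obtain e Y where Y: "\<And>i. Y i \<in> psd_mats e" "\<And>i j. B $ i $ j = trace_inner (Y i) (Y j)"
    using assms(2) unfolding completely_psd_def by blast
  have "transpose (A + B) = A + B"
    using assms by (simp add: completely_psd_def transpose_def Finite_Cartesian_Product.vec_eq_iff)
  moreover have "\<forall>i j. (A + B) $ i $ j
      = trace_inner (diag_sum (X i) (Y i)) (diag_sum (X j) (Y j))"
    using X Y by (auto simp: trace_inner_diag_sum[of _ d _ _ e] psd_mats_carrier)
  ultimately show ?thesis
    unfolding completely_psd_def using X Y
    by (intro conjI exI[of _ "d + e"] exI[of _ "\<lambda>i. diag_sum (X i) (Y i)"])
      (auto intro: diag_sum_psd_mats)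
qed

lemma completely_psd_scaleR:
  assumes "completely_psd A" and "0 \<le> c"
  shows "completely_psd (c *\<^sub>R A)"
proof -
  obtain d X where X: "d \<ge> 1" "\<And>i. X i \<in> psd_mats d" "\<And>i j. A $ i $ j = trace_inner (X i) (X j)"
    using assms(1) unfolding completely_psd_def by blast
  have "transpose (c *\<^sub>R A) = c *\<^sub>R A"
    using assms by (simp add: completely_psd_def transpose_def Finite_Cartesian_Product.vec_eq_iff)
  \<comment> \<open>Each entry is bilinear in its two factors, so each factor carries
    \<open>sqrt c\<close>; their product is \<open>c\<close> since \<open>0 \<le> c\<close>.\<close>
  moreover have "\<forall>i j. (c *\<^sub>R A) $ i $ j
      = trace_inner (sqrt c \<cdot>\<^sub>m X i) (sqrt c \<cdot>\<^sub>m X j)"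
    using X assms(2) by (auto simp: trace_inner_smult[of _ d] psd_mats_carrier)
  ultimately show ?thesis
    unfolding completely_psd_def using X assms(2)
    by (intro conjI exI[of _ d] exI[of _ "\<lambda>i. sqrt c \<cdot>\<^sub>m X i"])
      (auto intro: smult_psd_mats)
qed

theorem lemma3p2:
  shows "convex_cone (CS_plus :: (real^'n::finite^'n) set)"
  \<comment> \<open>A convex cone is characterised by containing 0 and being closed under sums and
    nonnegative scaling.\<close>
  unfolding convex_cone_iff CS_plus_def
  by (simp add: completely_psd_zero completely_psd_add completely_psd_scaleR)

end
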